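(* Let $\zeta$ denote the Riemann zeta function, let $p$ and $D$ be as in the context. Then for every $s\in\mathbb{C}$ with $\operatorname{Re} s>0$ and $s\neq 1$, \[ \zeta(s)=\frac{2s(1+s)}{(2\pi)^{1-s}}\left\{\frac{\pi^2}{6}\frac{1}{1+s}-\frac{\pi}{2}\frac{1}{s}-\frac14\frac{1}{1-s}-D(-2-s)\right\}. \]
   Context: Let $p:\mathbb{R}\to\mathbb{R}$ be the $2\pi$-periodic function given for $\theta\in[0,2\pi]$ by $p(\theta)=\frac{\pi^2}{6}-\frac{\theta(2\pi-\theta)}{4}$ (equivalently $p(\theta)=\sum_{n\ge1}\frac{\cos(n\theta)}{n^2}=\operatorname{Re}\mathrm{Li}_2(e^{i\theta})$, the associated Clausen function). For $\alpha\in\mathbb{C}$ with $\operatorname{Re}\alpha<-1$ define $D(\alpha)=\int_1^{+\infty}y^{\alpha}p(y)\,dy$. *)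

theory Defs
  imports "HOL-Complex_Analysis.Complex_Analysis" "HOL-Library.Real_Mod"
begin

text \<open>
  The Riemann zeta function, as the analytic continuation of the Dirichlet series to the whole
  plane without \<open>1\<close>. The continuation is unique on the connected set \<open>- {1}\<close>; the value of
  \<open>zeta\<close> at \<open>1\<close> is unspecified.
\<close>
definition zeta :: "complex \<Rightarrow> complex" where
  "zeta = (SOME f. f holomorphic_on - {1} \<and>
             (\<forall>s. Re s > 1 \<longrightarrow> (\<lambda>n. 1 / of_nat (Suc n) powr s) sums f s))"

text \<open>
  Here \<open>\<theta> rmod (2 * pi)\<close> is the representative of \<open>\<theta>\<close> in \<open>[0, 2\<pi>)\<close>. The quadratic takes the same
  value at \<open>0\<close> and \<open>2\<pi>\<close>, so the formula holds on the closed interval \<open>[0, 2\<pi>]\<close>.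
\<close>
definition p :: "real \<Rightarrow> real" where
  "p \<theta> = (let t = \<theta> rmod (2 * pi) in pi\<^sup>2 / 6 - t * (2 * pi - t) / 4)"

text \<open>
  The integral converges absolutely for \<open>Re \<alpha> < -1\<close>; only such \<open>\<alpha>\<close> are meaningful, since the
  Lebesgue integral of a non-integrable function is \<open>0\<close> by convention.
\<close>
definition D :: "complex \<Rightarrow> complex" where
  "D \<alpha> = (LINT y:{1..}|lborel. of_real y powr \<alpha> * of_real (p y))"

end

theory Submission
  imports Defs
begin

text \<open>
  The function \<open>p\<close> is \<open>\<pi>\<^sup>2 B\<^sub>2({\<theta> / 2\<pi>})\<close>, so the formula is a second-order Euler--Maclaurin formula. For
  \<open>Re s > 1\<close>, integrating \<open>y powr (-2 - s) * p y\<close> by parts twice over each period leaves only the jumps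
  of \<open>p'\<close> at the multiples of \<open>2\<pi>\<close>, and these add up to the Dirichlet series. Since \<open>p\<close> is periodic
  with mean zero, it has bounded periodic antiderivatives of every order; integrating by parts
  repeatedly extends \<open>D\<close> to an entire function. The right-hand side thus extends to
  \<open>- {1}\<close>, which shows that a function as in the definition of \<open>zeta\<close> exists, and the identity
  theorem yields the claim.
\<close>

section \<open>Mellin integrals over $[1, \infty)$\<close>

lemma at_within_atLeast_eq:
  fixes x :: real
  assumes "a \<le> x" "x < b"
  shows "at x within {a..} = at x within {a..b}"
  by (rule at_within_nhd[of _ "{..<b}"]) (use assms in auto)

lemma continuous_on_atLeastI:
  fixes f :: "real \<Rightarrow> 'a::topological_space"
  assumes "\<And>b. continuous_on {a..b} f"
  shows "continuous_on {a..} f"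
  unfolding continuous_on_eq_continuous_within
proof
  fix x :: real assume "x \<in> {a..}"
  with assms[of "x + 1"] show "continuous (at x within {a..}) f"
    by (simp add: at_within_atLeast_eq[of a x "x + 1"] continuous_on_eq_continuous_within)
qed

lemma set_integrable_powr_atLeast_1:
  fixes b :: real
  assumes "b < -1"
  shows "set_integrable lborel {1..} (\<lambda>y. y powr b)"
proof -
  have "(\<lambda>y. y powr b) absolutely_integrable_on {1..}"
    by (rule nonnegative_absolutely_integrable_1)
       (use has_integral_powr_to_inf[of b 1] assms in auto)
  moreover have "(\<lambda>y::real. indicator {1..} y *\<^sub>R (y powr b)) \<in> borel_measurable lborel"
    by measurable
  ultimately show ?thesis
    by (simp add: set_integrable_def integrable_completion)
qed

lemma norm_of_real_powr:
  fixes a :: complex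
  assumes "y > 0"
  shows "norm (of_real y powr a) = y powr Re a"
  using assms by (simp add: norm_powr_real_powr)

text \<open>\<open>D\<close> is the case where \<open>q\<close> is \<open>p\<close>. A general
  \<open>q\<close> is carried along because integration by parts replaces it by an
  antiderivative.\<close>

definition tail_mellin :: "(real \<Rightarrow> real) \<Rightarrow> complex \<Rightarrow> complex" where
  "tail_mellin q a = (LINT y:{1..}|lborel. of_real y powr a * of_real (q y))"

lemma continuous_on_of_real_powr_mult:
  fixes a :: complex
  assumes "continuous_on A q" "A \<subseteq> {0<..}"
  shows "continuous_on A (\<lambda>y. of_real y powr a * of_real (q y) :: complex)"
  using assms by (intro continuous_intros) (auto simp: complex_nonpos_Reals_iff)

lemma set_integrable_tail_mellin:
  assumes "continuous_on {1..} q" "\<And>y. y \<ge> 1 \<Longrightarrow> \<bar>q y\<bar> \<le> C" "Re a < -1"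
  shows "set_integrable lborel {1..} (\<lambda>y. of_real y powr a * of_real (q y) :: complex)"
proof (rule set_integrable_bound)
  show "set_integrable lborel {1..} (\<lambda>y. C * y powr Re a)"
    by (intro set_integrable_mult_right set_integrable_powr_atLeast_1 assms)
  show "set_borel_measurable lborel {1..} (\<lambda>y. of_real y powr a * of_real (q y) :: complex)"
    unfolding set_borel_measurable_def measurable_lborel2
    by (intro borel_measurable_continuous_on_indicator continuous_on_of_real_powr_mult assms) auto
  show "AE y in lborel. y \<in> {1..} \<longrightarrow>
          norm (of_real y powr a * of_real (q y) :: complex) \<le> norm (C * y powr Re a)"
  proof (intro AE_I2 impI)
    fix y :: real assume y: "y \<in> {1..}"
    then have "\<bar>q y\<bar> \<le> \<bar>C\<bar>" using assms(2)[of y] by auto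
    then show "norm (of_real y powr a * of_real (q y) :: complex) \<le> norm (C * y powr Re a)"
      using y by (simp add: norm_mult norm_of_real_powr abs_mult mult.commute mult_left_mono)
  qed
qed

text \<open>Passing from the Lebesgue integral over the half-line to Henstock-Kurzweil integrals
  over compact intervals makes the fundamental theorem of calculus and the Leibniz rule
  applicable.\<close>

lemma tail_mellin_tendsto:
  assumes "continuous_on {1..} q" "\<And>y. y \<ge> 1 \<Longrightarrow> \<bar>q y\<bar> \<le> C" "Re a < -1"
  shows "((\<lambda>b. integral {1..b} (\<lambda>y. of_real y powr a * of_real (q y))) \<longlongrightarrow> tail_mellin q a) at_top"
proof -
  have "((\<lambda>b. LINT y:{1..b}|lborel. of_real y powr a * of_real (q y)) \<longlongrightarrow> tail_mellin q a) at_top"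
    unfolding tail_mellin_def
    by (rule tendsto_set_lebesgue_integral_at_top) (use set_integrable_tail_mellin[OF assms] in auto)
  moreover have "(LINT y:{1..b}|lborel. of_real y powr a * of_real (q y))
      = integral {1..b} (\<lambda>y. of_real y powr a * of_real (q y) :: complex)" for b
    by (intro set_borel_integral_eq_integral borel_integrable_atLeastAtMost' 
          continuous_on_of_real_powr_mult continuous_on_subset[OF assms(1)]) auto
  ultimately show ?thesis by simp
qed

text \<open>The bound is \<open>C\<close> times the integral of \<open>y powr r\<close> over
  \<open>{b..}\<close>. It depends on \<open>a\<close> only through \<open>r\<close>, hence is
  uniform on the half-plane \<open>Re a \<le> r\<close>; this is what holomorphy of the limit
  requires.\<close>

lemma norm_tail_mellin_diff_le:
  assumes q: "continuous_on {1..} q" "\<And>y. y \<ge> 1 \<Longrightarrow> \<bar>q y\<bar> \<le> C"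
    and a: "Re a \<le> r" "r < -1" and b: "b \<ge> 1"
  shows "norm (tail_mellin q a - integral {1..b} (\<lambda>y. of_real y powr a * of_real (q y)))
           \<le> C * (b powr (r + 1) / - (r + 1))"
proof -
  let ?f = "\<lambda>y. of_real y powr a * of_real (q y) :: complex"
  \<comment> \<open>The estimate is proved for a finite upper limit \<open>c\<close> first and
    survives the limit as \<open>c\<close> tends to infinity.\<close>
  have "norm (integral {1..c} ?f - integral {1..b} ?f) \<le> C * (b powr (r + 1) / - (r + 1))"
    if c: "c \<ge> b" for c
  proof -
    have int: "?f integrable_on {u..v}" if "u \<ge> 1" for u v
      using that by (intro integrable_continuous_real continuous_on_of_real_powr_mult
          continuous_on_subset[OF q(1)]) auto
    have pint: "(\<lambda>y. y powr r) integrable_on {b..c}"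
      using b by (intro integrable_continuous_real continuous_intros) auto
    have hi: "((\<lambda>y. y powr r) has_integral - (b powr (r+1)) / (r+1)) {b..}"
      by (rule has_integral_powr_to_inf) (use a b in auto)
    have C0: "C \<ge> 0" using q(2)[of 1] by auto
    have "integral {1..c} ?f = integral {1..b} ?f + integral {b..c} ?f"
      by (rule Henstock_Kurzweil_Integration.integral_combine[symmetric]) (use b c int in auto)
    then have "norm (integral {1..c} ?f - integral {1..b} ?f) = norm (integral {b..c} ?f)" by simp
    also have "\<dots> \<le> integral {b..c} (\<lambda>y. C * y powr r)"
    proof (rule integral_norm_bound_integral)
      fix y assume y: "y \<in> {b..c}"
      have "norm (?f y) = y powr Re a * \<bar>q y\<bar>" using y b by (simp add: norm_mult norm_of_real_powr)
      also have "\<dots> \<le> y powr r * C"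
        using y b a q(2)[of y] by (intro mult_mono powr_mono) auto
      finally show "norm (?f y) \<le> C * y powr r" by (simp add: mult.commute)
    qed (use b int pint in \<open>auto intro!: integrable_on_mult_right\<close>)
    also have "\<dots> = C * integral {b..c} (\<lambda>y. y powr r)" by simp
    also have "\<dots> \<le> C * integral {b..} (\<lambda>y. y powr r)"
      by (intro mult_left_mono integral_subset_le C0 pint has_integral_integrable[OF hi]) auto
    also have "integral {b..} (\<lambda>y. y powr r) = b powr (r + 1) / - (r + 1)"
      unfolding integral_unique[OF hi] by (metis minus_divide_left minus_divide_right)
    finally show ?thesis .
  qed
  then have "eventually (\<lambda>c. norm (integral {1..c} ?f - integral {1..b} ?f)
               \<le> C * (b powr (r + 1) / - (r + 1))) at_top"
    using eventually_ge_at_top[of b] by (rule eventually_mono[rotated])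
  moreover have "((\<lambda>c. norm (integral {1..c} ?f - integral {1..b} ?f)) \<longlongrightarrow>
      norm (tail_mellin q a - integral {1..b} ?f)) at_top"
    by (intro tendsto_intros tail_mellin_tendsto[OF q]) (use a in auto)
  ultimately show ?thesis by (intro tendsto_upperbound) auto
qed

lemma holomorphic_integral_powr_mult:
  assumes "continuous_on {1..} q"
  shows "(\<lambda>a. integral {1..b} (\<lambda>y. of_real y powr a * of_real (q y) :: complex)) holomorphic_on UNIV"
proof -
  have "(\<lambda>a. integral (cbox 1 b) (\<lambda>y. of_real y powr a * of_real (q y) :: complex)) holomorphic_on UNIV"
  proof (rule leibniz_rule_holomorphic)
    fix a :: complex and t :: real assume "t \<in> cbox 1 b"
    then show "((\<lambda>a. of_real t powr a * of_real (q t)) has_field_derivative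
        Ln (of_real t) * of_real t powr a * of_real (q t)) (at a within UNIV)"
      by (auto intro!: derivative_eq_intros)
  next
    fix a :: complex
    show "(\<lambda>y. of_real y powr a * of_real (q y) :: complex) integrable_on cbox 1 b"
      by (auto intro!: integrable_continuous_real continuous_on_of_real_powr_mult
          continuous_on_subset[OF assms(1)])
  next
    have "continuous_on (UNIV \<times> cbox 1 b) (\<lambda>x::complex \<times> real. q (snd x))"
      by (rule continuous_on_compose2[OF assms]) (auto intro!: continuous_intros)
    then show "continuous_on (UNIV \<times> cbox 1 b)
        (\<lambda>(a, t). Ln (of_real t) * of_real t powr a * of_real (q t) :: complex)"
      unfolding case_prod_beta
      by (intro continuous_intros) (auto simp: complex_nonpos_Reals_iff)
  qed auto
  then show ?thesis by simp
qed

text \<open>The truncated integrals are entire in the exponent, and by the uniform tail bound they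
  converge locally uniformly.\<close>

lemma holomorphic_tail_mellin:
  assumes q: "continuous_on {1..} q" "\<And>y. y \<ge> 1 \<Longrightarrow> \<bar>q y\<bar> \<le> C"
  shows "tail_mellin q holomorphic_on {a. Re a < -1}"
proof (rule holomorphic_uniform_sequence)
  let ?I = "\<lambda>b a. integral {1..b} (\<lambda>y. of_real y powr a * of_real (q y) :: complex)"
  show "open {a. Re a < -1}" by (rule open_halfspace_Re_lt)
  show "?I (real n + 1) holomorphic_on {a. Re a < -1}" for n
    using holomorphic_integral_powr_mult[OF q(1)] by (rule holomorphic_on_subset) auto
  fix z assume z: "z \<in> {a. Re a < -1}"
  \<comment> \<open>The midpoint of \<open>Re z\<close> and -1: the closed ball of radius
    \<open>r - Re z\<close> about \<open>z\<close> then stays in \<open>Re a \<le> r\<close>, at a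
    positive distance from the line \<open>Re a = -1\<close>.\<close>
  define r where "r = (Re z - 1) / 2"
  have r: "r < -1" "Re z < r" using z by (auto simp: r_def)
  have ball: "Re a \<le> r" if "a \<in> cball z (r - Re z)" for a
  proof -
    have "Re a - Re z \<le> norm (a - z)" by (metis complex_Re_le_cmod minus_complex.sel(1))
    then show ?thesis using that by (simp add: dist_norm norm_minus_commute)
  qed
  have "uniform_limit (cball z (r - Re z)) (\<lambda>n. ?I (real n + 1)) (tail_mellin q) sequentially"
  proof (rule uniform_limitI)
    fix e :: real assume e: "e > 0"
    have lim: "filterlim (\<lambda>n. real n + 1) at_top sequentially"
      using filterlim_compose[OF filterlim_real_sequentially filterlim_Suc] by (simp add: add.commute)
    have "((\<lambda>x. C * (x powr (r + 1) / - (r + 1))) \<longlongrightarrow> C * (0 / - (r + 1))) at_top"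
      by (intro tendsto_intros tendsto_neg_powr filterlim_ident) (use r in auto)
    then have "((\<lambda>n. C * ((real n + 1) powr (r + 1) / - (r + 1))) \<longlonglongrightarrow> C * (0 / - (r + 1)))"
      by (rule filterlim_compose) (rule lim)
    then have "eventually (\<lambda>n. C * ((real n + 1) powr (r + 1) / - (r + 1)) < e) sequentially"
      using e by (intro order_tendstoD) auto
    then show "\<forall>\<^sub>F n in sequentially. \<forall>a\<in>cball z (r - Re z). dist (?I (real n + 1) a) (tail_mellin q a) < e"
    proof eventually_elim
      case (elim n)
      show ?case
      proof
        fix a assume "a \<in> cball z (r - Re z)"
        then have "norm (tail_mellin q a - ?I (real n + 1) a) \<le> C * ((real n + 1) powr (r + 1) / - (r + 1))"
          by (intro norm_tail_mellin_diff_le q ball r) auto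
        with elim show "dist (?I (real n + 1) a) (tail_mellin q a) < e"
          by (simp add: dist_norm norm_minus_commute)
      qed
    qed
  qed
  then show "\<exists>d>0. cball z d \<subseteq> {a. Re a < -1} \<and>
      uniform_limit (cball z d) (\<lambda>n. ?I (real n + 1)) (tail_mellin q) sequentially"
    using r ball by (intro exI[of _ "r - Re z"]) (auto dest!: ball)
qed

section \<open>Integration by parts on the half-line\<close>

lemma has_vector_derivative_of_real_powr:
  fixes a :: complex
  assumes "y > 0"
  shows "((\<lambda>y. of_real y powr a) has_vector_derivative a * of_real y powr (a - 1)) (at y within A)"
proof -
  have "((\<lambda>z. z powr a) has_field_derivative a * of_real y powr (a - 1)) (at (of_real y))"
    using assms by (intro has_field_derivative_powr) (auto simp: complex_nonpos_Reals_iff)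
  then have "((\<lambda>y. of_real y powr a) has_vector_derivative a * of_real y powr (a - 1)) (at y)"
    by (rule has_vector_derivative_real_field)
  then show ?thesis by (rule has_vector_derivative_at_within)
qed

text \<open>The boundary term at infinity vanishes because \<open>Q\<close> is bounded and
  \<open>Re a\<close> is negative; the one at 1 is \<open>Q 1\<close>. The gain is the lowered
  exponent: the integral on the right converges absolutely already for
  \<open>Re a < 0\<close>.\<close>

lemma tail_mellin_by_parts:
  assumes q: "continuous_on {1..} q" "\<And>y. y \<ge> 1 \<Longrightarrow> \<bar>q y\<bar> \<le> C"
    and Q: "continuous_on {1..} Q" "\<And>y. y \<ge> 1 \<Longrightarrow> \<bar>Q y\<bar> \<le> C'"
    and deriv: "\<And>y. y \<ge> 1 \<Longrightarrow> (Q has_real_derivative q y) (at y)"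
    and a: "Re a < -1"
  shows "tail_mellin q a = - of_real (Q 1) - a * tail_mellin Q (a - 1)"
proof -
  let ?P = "\<lambda>y. of_real y powr a * of_real (Q y) :: complex"
  let ?I = "\<lambda>q a b. integral {1..b} (\<lambda>y. of_real y powr a * of_real (q y) :: complex)"
  have eq: "?I q a b = ?P b - of_real (Q 1) - a * ?I Q (a - 1) b" if b: "b \<ge> 1" for b
  proof -
    have "((\<lambda>y. of_real y powr a * of_real (q y) + a * (of_real y powr (a - 1) * of_real (Q y)))
            has_integral ?P b - ?P 1) {1..b}"
    proof (rule fundamental_theorem_of_calculus[OF b])
      fix y assume y: "y \<in> {1..b}"
      have "((\<lambda>y. complex_of_real (Q y)) has_vector_derivative of_real (q y)) (at y within {1..b})"
        using deriv[of y] y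
        by (intro has_vector_derivative_of_real has_vector_derivative_at_within)
           (auto simp: has_real_derivative_iff_has_vector_derivative)
      then show "(?P has_vector_derivative
          of_real y powr a * of_real (q y) + a * (of_real y powr (a - 1) * of_real (Q y)))
          (at y within {1..b})"
        using has_vector_derivative_mult[OF has_vector_derivative_of_real_powr[of y a "{1..b}"]] y
        by (simp add: mult.assoc)
    qed
    then have "integral {1..b} (\<lambda>y. of_real y powr a * of_real (q y) + a * (of_real y powr (a - 1) * of_real (Q y)))
        = ?P b - of_real (Q 1)" 
      by (simp add: integral_unique)
    moreover have "integral {1..b} (\<lambda>y. of_real y powr a * of_real (q y) + a * (of_real y powr (a - 1) * of_real (Q y)))
        = ?I q a b + a * ?I Q (a - 1) b"
    proof (subst Henstock_Kurzweil_Integration.integral_add)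
      show "(\<lambda>y. of_real y powr a * of_real (q y) :: complex) integrable_on {1..b}"
        by (intro integrable_continuous_real continuous_on_of_real_powr_mult
          continuous_on_subset[OF q(1)]) auto
      show "(\<lambda>y. a * (of_real y powr (a - 1) * of_real (Q y)) :: complex) integrable_on {1..b}"
        by (intro integrable_continuous_real continuous_on_mult continuous_on_const
          continuous_on_of_real_powr_mult[of _ Q "a - 1"] continuous_on_subset[OF Q(1)]) auto
    qed simp
    ultimately show ?thesis by (simp add: algebra_simps)
  qed
  have "(?P \<longlongrightarrow> 0) at_top"
  proof (rule Lim_null_comparison)
    show "eventually (\<lambda>y. norm (?P y) \<le> C' * y powr Re a) at_top"
      using eventually_ge_at_top[of 1]
    proof eventually_elim
      case (elim y)
      then show ?case using Q(2)[of y]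
        by (simp add: norm_mult norm_of_real_powr mult.commute mult_right_mono)
    qed
    have "((\<lambda>y. C' * y powr Re a) \<longlongrightarrow> C' * 0) at_top"
      by (intro tendsto_intros tendsto_neg_powr filterlim_ident) (use a in auto)
    then show "((\<lambda>y. C' * y powr Re a) \<longlongrightarrow> 0) at_top" by simp
  qed
  then have "((\<lambda>b. ?P b - of_real (Q 1) - a * ?I Q (a - 1) b) \<longlongrightarrow>
               0 - of_real (Q 1) - a * tail_mellin Q (a - 1)) at_top"
    by (intro tendsto_intros tail_mellin_tendsto[OF Q]) (use a in auto)
  moreover have "eventually (\<lambda>b. ?I q a b = ?P b - of_real (Q 1) - a * ?I Q (a - 1) b) at_top"
    using eventually_ge_at_top[of 1] by eventually_elim (rule eq)
  ultimately have "(?I q a \<longlongrightarrow> 0 - of_real (Q 1) - a * tail_mellin Q (a - 1)) at_top"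
    by (simp add: filterlim_cong)
  from tendsto_unique[OF _ tail_mellin_tendsto[OF q a] this] show ?thesis by simp
qed

section \<open>Continuation for periodic functions of mean zero\<close>

text \<open>Periodicity is only asked for on the nonnegative half-line, because the antiderivatives
  below are built from integrals over \<open>{0..x}\<close>, which are 0 for negative
  \<open>x\<close>.\<close>

lemma periodic_add_nat:
  fixes q :: "real \<Rightarrow> 'a"
  assumes "T > 0" "\<forall>x\<ge>0. q (x + T) = q x" "x \<ge> 0"
  shows "q (x + real n * T) = q x"
proof (induction n)
  case (Suc n)
  have "q (x + real (Suc n) * T) = q ((x + real n * T) + T)" by (simp add: algebra_simps)
  also have "\<dots> = q (x + real n * T)" using assms by simp
  finally show ?case using Suc by simp
qed simp

lemma periodic_bounded:
  fixes q :: "real \<Rightarrow> real"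
  assumes "T > 0" "continuous_on {0..} q" "\<forall>x\<ge>0. q (x + T) = q x"
  shows "\<exists>C. \<forall>x\<ge>0. \<bar>q x\<bar> \<le> C"
proof -
  have "bounded (q ` {0..T})"
    by (intro compact_imp_bounded compact_continuous_image continuous_on_subset[OF assms(2)]) auto
  then obtain C where C: "\<And>x. x \<in> {0..T} \<Longrightarrow> \<bar>q x\<bar> \<le> C"
    unfolding bounded_iff by fastforce
  have "\<bar>q x\<bar> \<le> C" if "x \<ge> 0" for x
  proof -
    define n where "n = nat \<lfloor>x / T\<rfloor>"
    have "real n = of_int \<lfloor>x / T\<rfloor>" using that assms(1) by (simp add: n_def)
    then have "real n \<le> x / T" "x / T < real n + 1" by linarith+
    then have "real n * T \<le> x" "x < real n * T + T"
      using assms(1) by (simp_all add: field_simps)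
    then show ?thesis
      using C[of "x - real n * T"] periodic_add_nat[of T q "x - real n * T" n] assms by auto
  qed
  then show ?thesis by blast
qed

text \<open>Mean zero of \<open>q\<close> makes its antiderivatives periodic, and a suitable
  constant of integration gives the antiderivative mean zero as well. The conclusion thus reproduces
  the hypotheses, and the construction can be iterated.\<close>

lemma periodic_antiderivative:
  fixes q :: "real \<Rightarrow> real"
  assumes T: "T > 0" and q: "continuous_on {0..} q" "\<forall>x\<ge>0. q (x + T) = q x"
    and mean: "integral {0..T} q = 0"
  obtains Q where "continuous_on {0..} Q" "\<forall>x\<ge>0. Q (x + T) = Q x" "integral {0..T} Q = 0"
    "\<forall>x>0. (Q has_real_derivative q x) (at x)"
proof -
  define Q0 where "Q0 = (\<lambda>x. integral {0..x} q)"
  \<comment> \<open>The subtracted constant is the mean of \<open>Q0\<close> over one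
    period.\<close>
  define Q where "Q = (\<lambda>x. Q0 x - integral {0..T} Q0 / T)"
  have deriv0: "(Q0 has_real_derivative q x) (at x within {0..})" if "x \<ge> 0" for x
    using integral_has_real_derivative[of 0 "x + 1" q x] that continuous_on_subset[OF q(1), of "{0..x+1}"]
    by (simp add: Q0_def at_within_atLeast_eq[of 0 x "x + 1"])
  then have deriv: "(Q has_real_derivative q x) (at x within {0..})" if "x \<ge> 0" for x
    unfolding Q_def using that by (auto intro!: derivative_eq_intros)
  have cont0: "continuous_on {0..} Q0" and cont: "continuous_on {0..} Q"
    using deriv0 deriv by (auto intro!: DERIV_continuous_on)
  have "\<exists>c. \<forall>x\<in>{0..}. Q (x + T) - Q x = c"
  proof (rule has_field_derivative_zero_constant)
    fix x :: real assume x: "x \<in> {0..}"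
    have "((\<lambda>x. x + T) has_real_derivative 1) (at x within {0..})"
      by (auto intro!: derivative_eq_intros)
    moreover have "(Q has_real_derivative q (x + T)) (at (x + T) within (\<lambda>x. x + T) ` {0..})"
      by (rule DERIV_subset[OF deriv]) (use x T in auto)
    ultimately have "((\<lambda>x. Q (x + T)) has_real_derivative q (x + T)) (at x within {0..})"
      using DERIV_image_chain[of Q "q (x + T)" "\<lambda>x. x + T" x "{0..}" 1] by (simp add: o_def)
    from DERIV_diff[OF this deriv[of x]] x q(2)
    show "((\<lambda>x. Q (x + T) - Q x) has_real_derivative 0) (at x within {0..})" by simp
  qed simp
  then obtain c where c: "\<And>x. x \<ge> 0 \<Longrightarrow> Q (x + T) - Q x = c" by auto
  \<comment> \<open>At 0 the difference \<open>Q (x + T) - Q x\<close> is the integral of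
    \<open>q\<close> over a full period.\<close>
  have "c = 0" using c[of 0] mean by (simp add: Q_def Q0_def)
  have "integral {0..T} Q = integral {0..T} Q0 - integral {0..T} (\<lambda>_. integral {0..T} Q0 / T)"
    unfolding Q_def
    by (intro Henstock_Kurzweil_Integration.integral_diff integrable_continuous_real
          continuous_on_subset[OF cont0] continuous_on_const) auto
  then have "integral {0..T} Q = 0" using T by simp
  moreover have "(Q has_real_derivative q x) (at x)" if "x > 0" for x
    using deriv[of x] that at_within_interior[of x "{0..}"] by simp
  ultimately show thesis using that[of Q] cont c \<open>c = 0\<close> by auto
qed

text \<open>Each integration by parts moves the boundary of the half-plane one unit to the right.
  The induction hypothesis is applied to the periodic antiderivative of \<open>q\<close>, so
  \<open>q\<close> has to vary.\<close>

lemma tail_mellin_extends: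
  fixes q :: "real \<Rightarrow> real"
  assumes T: "T > 0" and "continuous_on {0..} q" "\<forall>x\<ge>0. q (x + T) = q x"
    and "integral {0..T} q = 0"
  shows "\<exists>h. h holomorphic_on {a. Re a < real N - 1} \<and> (\<forall>a. Re a < -1 \<longrightarrow> h a = tail_mellin q a)"
  using assms(2-)
proof (induction N arbitrary: q)
  case 0
  obtain C where "\<And>x. x \<ge> 0 \<Longrightarrow> \<bar>q x\<bar> \<le> C"
    using periodic_bounded[OF T "0.prems"(1,2)] by blast
  then have "tail_mellin q holomorphic_on {a. Re a < -1}"
    by (intro holomorphic_tail_mellin[where C = C] continuous_on_subset[OF 0(1)]) auto
  then show ?case by auto
next
  case (Suc N)
  obtain C where C: "\<And>x. x \<ge> 0 \<Longrightarrow> \<bar>q x\<bar> \<le> C"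
    using periodic_bounded[OF T Suc.prems(1,2)] by blast
  obtain Q where Q: "continuous_on {0..} Q" "\<forall>x\<ge>0. Q (x + T) = Q x"
    "integral {0..T} Q = 0" "\<forall>x>0. (Q has_real_derivative q x) (at x)"
    by (rule periodic_antiderivative[OF T Suc.prems])
  obtain C' where C': "\<And>x. x \<ge> 0 \<Longrightarrow> \<bar>Q x\<bar> \<le> C'"
    using periodic_bounded[OF T Q(1,2)] by blast
  obtain h where h: "h holomorphic_on {a. Re a < real N - 1}"
    "\<And>a. Re a < -1 \<Longrightarrow> h a = tail_mellin Q a"
    using Suc.IH[OF Q(1-3)] by blast
  have "(h \<circ> (\<lambda>a. a - 1)) holomorphic_on {a. Re a < real (Suc N) - 1}"
    by (rule holomorphic_on_compose[OF _ holomorphic_on_subset[OF h(1)]])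
       (auto intro!: holomorphic_intros)
  then have "(\<lambda>a. - of_real (Q 1) - a * h (a - 1)) holomorphic_on {a. Re a < real (Suc N) - 1}"
    by (auto intro!: holomorphic_intros simp: o_def)
  moreover have "- of_real (Q 1) - a * h (a - 1) = tail_mellin q a" if "Re a < -1" for a
  proof -
    have "tail_mellin q a = - of_real (Q 1) - a * tail_mellin Q (a - 1)"
      by (rule tail_mellin_by_parts[of q C Q C'])
         (use that C C' Q(4) in \<open>auto intro: continuous_on_subset[OF Suc.prems(1)] continuous_on_subset[OF Q(1)]\<close>)
    with that show ?thesis by (simp add: h(2))
  qed
  ultimately show ?case by blast
qed

text \<open>The extensions to the growing half-planes agree on overlaps by the identity theorem, so
  they glue to one entire function.\<close>

lemma tail_mellin_entire:
  fixes q :: "real \<Rightarrow> real"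
  assumes "T > 0" "continuous_on {0..} q" "\<forall>x\<ge>0. q (x + T) = q x" "integral {0..T} q = 0"
  obtains H where "H holomorphic_on UNIV" "\<And>a. Re a < -1 \<Longrightarrow> H a = tail_mellin q a"
proof -
  have "\<forall>N. \<exists>h. h holomorphic_on {a. Re a < real N - 1} \<and> (\<forall>a. Re a < -1 \<longrightarrow> h a = tail_mellin q a)"
    using tail_mellin_extends[OF assms] by blast
  from choice[OF this] obtain h where
    "\<forall>N. h N holomorphic_on {a. Re a < real N - 1} \<and> (\<forall>a. Re a < -1 \<longrightarrow> h N a = tail_mellin q a)" ..
  then have h: "h N holomorphic_on {a. Re a < real N - 1}"
    "Re a < -1 \<Longrightarrow> h N a = tail_mellin q a" for N a
    by simp_all
  have agree: "h M a = h N a" if "M \<le> N" "Re a < real M - 1" for M N a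
  proof (rule analytic_continuation_open[of "{a. Re a < -1}" "{a. Re a < real M - 1}" "h M" "h N"])
    show "{a. Re a < -1} \<noteq> {}" by (auto intro!: exI[of _ "-2"])
    show "connected {a. Re a < real M - 1}" by (intro convex_connected convex_halfspace_Re_lt)
    show "h N holomorphic_on {a. Re a < real M - 1}"
      by (rule holomorphic_on_subset[OF h(1)]) (use that in auto)
  qed (use that h in \<open>auto simp: open_halfspace_Re_lt\<close>)
  \<comment> \<open>\<open>ix a\<close> picks some half-plane containing \<open>a\<close>; adding 2
    instead of 1 under the ceiling makes the inequality strict.\<close>
  define ix :: "complex \<Rightarrow> nat" where "ix = (\<lambda>a. nat \<lceil>Re a + 2\<rceil>)"
  have ix: "Re a < real (ix a) - 1" for a unfolding ix_def by linarith
  define H where "H = (\<lambda>a. h (ix a) a)"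
  have H_eq: "H a = h N a" if "Re a < real N - 1" for N a
    unfolding H_def using agree[of N "ix a" a] agree[of "ix a" N a] ix[of a] that
    by (metis nat_le_linear)
  have "H holomorphic_on {a. Re a < real N - 1}" for N
    using h(1)[of N] by (rule holomorphic_transform) (rule H_eq[symmetric], simp)
  then have "H holomorphic_on (\<Union>N. {a. Re a < real N - 1})"
    by (intro holomorphic_on_UN_open) (auto simp: open_halfspace_Re_lt)
  moreover have "(\<Union>N. {a. Re a < real N - 1}) = UNIV" using ix by blast
  moreover have "H a = tail_mellin q a" if "Re a < -1" for a
    unfolding H_def using that by (rule h(2))
  ultimately show thesis using that[of H] by simp
qed

section \<open>The Clausen function and the zeta function\<close>

text \<open>At the right endpoint \<open>rmod\<close> has already dropped to 0, but the parabola
  takes the same value at both ends. Having the formula on closed periods allows gluing for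
  continuity and integrating up to the endpoints.\<close>

lemma p_eq:
  assumes "y \<in> {2 * pi * real n..2 * pi * real (Suc n)}"
  shows "p y = pi\<^sup>2 / 6 - (y - 2 * pi * real n) * (2 * pi - (y - 2 * pi * real n)) / 4"
proof (cases "y = 2 * pi * real (Suc n)")
  case True
  then have "y rmod (2 * pi) = 0" by (simp only: rmod_self_multiple_nat')
  then show ?thesis using True by (simp add: p_def Let_def algebra_simps)
next
  case False
  then have "y rmod (2 * pi) = y - 2 * pi * real n"
    using assms by (intro rmod_unique[of _ _ _ "int n"]) (auto simp: algebra_simps)
  then show ?thesis by (simp add: p_def Let_def)
qed

lemma p_periodic: "p (x + 2 * pi) = p x"
proof -
  have "[x = x + 2 * pi] (rmod (2 * pi))"
    unfolding rcong_altdef by (rule exI[of _ 1]) simp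
  then show ?thesis by (simp add: p_def rcong_def)
qed

lemma continuous_on_p: "continuous_on {0..} p"
proof (rule continuous_on_atLeastI)
  fix b :: real
  have "continuous_on {0..2 * pi * real n} p" for n
  proof (induction n)
    case (Suc n)
    have "continuous_on {2 * pi * real n..2 * pi * real (Suc n)} p"
      by (subst continuous_on_cong[OF refl p_eq]) (auto intro!: continuous_intros)
    with Suc have "continuous_on ({0..2 * pi * real n} \<union> {2 * pi * real n..2 * pi * real (Suc n)}) p"
      by (intro continuous_on_closed_Un) auto
    then show ?case by (subst (asm) ivl_disj_un_two_touch) auto
  qed simp
  moreover have "{0..b} \<subseteq> {0..2 * pi * real (nat \<lceil>b\<rceil>)}"
  proof -
    have "b \<le> 1 * real (nat \<lceil>b\<rceil>)" by linarith
    also have "\<dots> \<le> 2 * pi * real (nat \<lceil>b\<rceil>)"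
      using pi_ge_two by (intro mult_right_mono) auto
    finally show ?thesis by auto
  qed
  ultimately show "continuous_on {0..b} p" by (rule continuous_on_subset)
qed

text \<open>This is the mean-zero condition that starts the continuation of
  \<open>D\<close>.\<close>

lemma integral_p: "integral {0..2 * pi} p = 0"
proof -
  let ?F = "\<lambda>t::real. pi\<^sup>2 / 6 * t - pi * t ^ 2 / 4 + t ^ 3 / 12"
  have "(p has_integral ?F (2 * pi) - ?F 0) {0..2 * pi}"
  proof (rule fundamental_theorem_of_calculus)
    fix t assume t: "t \<in> {0..2 * pi}"
    have "(?F has_real_derivative pi\<^sup>2 / 6 - t * (2 * pi - t) / 4) (at t within {0..2 * pi})"
      by (auto intro!: derivative_eq_intros simp: field_simps power2_eq_square)
    with t show "(?F has_vector_derivative p t) (at t within {0..2 * pi})"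
      using p_eq[of t 0] by (simp add: has_real_derivative_iff_has_vector_derivative)
  qed simp
  then show ?thesis by (simp add: integral_unique power2_eq_square power3_eq_cube)
qed

section \<open>Explicit evaluation over finitely many periods\<close>

text \<open>
  Here \<open>\<Phi>\<close> comes from integrating by parts twice: \<open>(y - c - pi) / 2\<close> is \<open>P'\<close>, and \<open>P'' = 1 / 2\<close>.
\<close>
lemma has_integral_powr_mult_parabola:
  fixes s :: complex and c u v :: real
  assumes s: "s \<noteq> 0" "s \<noteq> 1" "1 + s \<noteq> 0" and uv: "0 < u" "u \<le> v"
  defines "P \<equiv> \<lambda>y::real. pi\<^sup>2 / 6 - (y - c) * (2 * pi - (y - c)) / 4"
  defines "\<Phi> \<equiv> \<lambda>y. - (1 / (1 + s)) * (of_real y powr (-1 - s) * of_real (P y))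
                     - 1 / (s * (1 + s)) * (of_real y powr (- s) * of_real ((y - c - pi) / 2))
                     + 1 / (2 * s * (1 + s) * (1 - s)) * of_real y powr (1 - s)"
  shows "((\<lambda>y. of_real y powr (-2 - s) * of_real (P y)) has_integral \<Phi> v - \<Phi> u) {u..v}"
proof (rule fundamental_theorem_of_calculus)
  fix y assume y: "y \<in> {u..v}"
  let ?w = "\<lambda>b. of_real y powr b :: complex" and ?F = "at y within {u..v}"
  have y0: "y > 0" using y uv by simp
  have dP: "((\<lambda>y. complex_of_real (P y)) has_vector_derivative of_real ((y - c - pi) / 2)) ?F"
  proof (rule has_vector_derivative_of_real)
    show "(P has_real_derivative (y - c - pi) / 2) ?F"
      unfolding P_def by (auto intro!: derivative_eq_intros simp: field_simps)
  qed
  have dP': "((\<lambda>y. complex_of_real ((y - c - pi) / 2)) has_vector_derivative of_real (1 / 2)) ?F"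
  proof (rule has_vector_derivative_of_real)
    show "((\<lambda>y. (y - c - pi) / 2) has_real_derivative 1 / 2) ?F"
      by (auto intro!: derivative_eq_intros)
  qed
  \<comment> \<open>Naming the lowered exponent \<open>b'\<close> separately lets the derivatives
    appear directly with the exponents \<open>-2 - s\<close>, \<open>-1 - s\<close> and
    \<open>- s\<close>.\<close>
  have d: "((\<lambda>y. of_real y powr b) has_vector_derivative b * ?w b') ?F" if "b' = b - 1" for b b'
    unfolding that using y0 by (rule has_vector_derivative_of_real_powr)
  have "(\<Phi> has_vector_derivative
      - (1 / (1 + s)) * (?w (-1 - s) * of_real ((y - c - pi) / 2) + (-1 - s) * ?w (-2 - s) * of_real (P y))
      - 1 / (s * (1 + s)) * (?w (- s) * of_real (1 / 2) + - s * ?w (-1 - s) * of_real ((y - c - pi) / 2))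
      + 1 / (2 * s * (1 + s) * (1 - s)) * ((1 - s) * ?w (- s))) ?F"
    unfolding \<Phi>_def
    by (intro has_vector_derivative_add has_vector_derivative_diff has_vector_derivative_mult_right
        has_vector_derivative_mult d dP dP') simp_all
  also have "- (1 / (1 + s)) * (?w (-1 - s) * of_real ((y - c - pi) / 2) + (-1 - s) * ?w (-2 - s) * of_real (P y))
      - 1 / (s * (1 + s)) * (?w (- s) * of_real (1 / 2) + - s * ?w (-1 - s) * of_real ((y - c - pi) / 2))
      + 1 / (2 * s * (1 + s) * (1 - s)) * ((1 - s) * ?w (- s)) = ?w (-2 - s) * of_real (P y)"
  proof -
    \<comment> \<open>With the three powers, \<open>P'\<close> and \<open>P\<close> as free
      variables, the terms in \<open>w1 * x\<close> cancel between the first two lines and those in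
      \<open>w2\<close> between the last two.\<close>
    have alg: "- (1 / (1 + s)) * (w1 * x + (-1 - s) * w0 * q)
      - 1 / (s * (1 + s)) * (w2 * (1 / 2) + - s * w1 * x)
      + 1 / (2 * s * (1 + s) * (1 - s)) * ((1 - s) * w2) = w0 * q" for w0 w1 w2 x q :: complex
    proof -
      have "- (1 / (1 + s)) * (w1 * x + (-1 - s) * w0 * q) = w0 * q - w1 * x / (1 + s)"
        using s by (simp add: field_simps)
      moreover have "1 / (s * (1 + s)) * (w2 * (1 / 2) + - s * w1 * x) = w2 / (2 * s * (1 + s)) - w1 * x / (1 + s)"
        using s by (simp add: diff_divide_distrib mult.assoc)
      moreover have "1 / (2 * s * (1 + s) * (1 - s)) * ((1 - s) * w2) = w2 / (2 * s * (1 + s))"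
        using s by simp
      ultimately show ?thesis by simp
    qed
    have "complex_of_real (1 / 2) = 1 / 2" by simp
    then show ?thesis by (simp only: alg)
  qed
  finally show "(\<Phi> has_vector_derivative ?w (-2 - s) * of_real (P y)) ?F" .
qed (use uv in simp)

text \<open>
  The right-hand side with its denominators \<open>s\<close> and \<open>1 + s\<close> cancelled, which removes the singularities
  at \<open>0\<close> and \<open>-1\<close>. The parameter \<open>E\<close> stands for \<open>D\<close> or its entire extension.
\<close>
definition zeta_rhs :: "(complex \<Rightarrow> complex) \<Rightarrow> complex \<Rightarrow> complex" where
  "zeta_rhs E s = of_real (2 * pi) powr (s - 1) * (of_real (pi\<^sup>2 / 3) * s - of_real pi * (1 + s)
      - s * (1 + s) / (2 * (1 - s)) - 2 * s * (1 + s) * E (- 2 - s))"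

lemma zeta_rhs_eq:
  assumes "s \<noteq> 0" "s \<noteq> 1" "1 + s \<noteq> 0"
  shows "zeta_rhs E s = 2 * s * (1 + s) / of_real (2 * pi) powr (1 - s) *
           (of_real (pi\<^sup>2 / 6) * (1 / (1 + s)) - of_real (pi / 2) * (1 / s)
              - 1 / 4 * (1 / (1 - s)) - E (- 2 - s))"
proof -
  have "of_real (2 * pi) powr (s - 1) = 1 / (of_real (2 * pi) powr (1 - s) :: complex)"
    by (metis minus_diff_eq powr_minus_divide)
  moreover have "of_real (pi\<^sup>2 / 3) * s - of_real pi * (1 + s)
      - s * (1 + s) / (2 * (1 - s)) - 2 * s * (1 + s) * e
    = 2 * s * (1 + s) * (of_real (pi\<^sup>2 / 6) * (1 / (1 + s)) - of_real (pi / 2) * (1 / s)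
              - 1 / 4 * (1 / (1 - s)) - e)" for e
  proof -
    have "2 * s * (1 + s) * (A * (1 / (1 + s))) = 2 * A * s" for A
      using assms by simp
    from this[of "of_real (pi\<^sup>2 / 6)"]
    have "2 * s * (1 + s) * (of_real (pi\<^sup>2 / 6) * (1 / (1 + s))) = of_real (pi\<^sup>2 / 3) * s"
      by simp
    moreover have "2 * s * (1 + s) * (of_real (pi / 2) * (1 / s)) = of_real pi * (1 + s)"
      using assms by simp
    moreover have "2 * s * (1 + s) * (1 / 4 * (1 / b)) = s * (1 + s) / (2 * b)" for b
      by simp
    ultimately show ?thesis by (simp only: right_diff_distrib)
  qed
  ultimately show ?thesis unfolding zeta_rhs_def by simp
qed

text \<open>At multiples of 2 pi the parabola equals \<open>pi\<^sup>2 / 6\<close> from both sides,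
  so the \<open>U\<close> terms telescope. Its slope is pi/2 at the right end of a period and -pi/2
  at the left end of the next, so an interior multiple of 2 pi contributes \<open>\<kappa>\<close>
  twice and the last endpoint once.\<close>

lemma integral_powr_mult_p:
  fixes s :: complex
  assumes s: "s \<noteq> 0" "s \<noteq> 1" "1 + s \<noteq> 0"
  defines "U \<equiv> \<lambda>y::real. - (1 / (1 + s)) * (of_real y powr (-1 - s) * of_real (pi\<^sup>2 / 6))
                     + 1 / (2 * s * (1 + s) * (1 - s)) * of_real y powr (1 - s)"
    and "\<kappa> \<equiv> of_real pi / (2 * s * (1 + s))"
  shows "integral {1..2 * pi * real (Suc N)} (\<lambda>y. of_real y powr (-2 - s) * of_real (p y)) =
           of_real (pi\<^sup>2 / 6) * (1 / (1 + s)) - of_real (pi / 2) * (1 / s) - 1 / 4 * (1 / (1 - s))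
           + U (2 * pi * real (Suc N)) - \<kappa> * of_real (2 * pi * real (Suc N)) powr (- s)
           - 2 * \<kappa> * (\<Sum>n<N. of_real (2 * pi * real (Suc n)) powr (- s))"
proof -
  let ?f = "\<lambda>y. of_real y powr (-2 - s) * of_real (p y) :: complex"
  let ?T = "\<lambda>n. 2 * pi * real n"
  let ?c = "of_real (pi\<^sup>2 / 6) * (1 / (1 + s)) - of_real (pi / 2) * (1 / s) - 1 / 4 * (1 / (1 - s))"
  define \<Phi> where "\<Phi> = (\<lambda>(c::real) (y::real).
      - (1 / (1 + s)) * (of_real y powr (-1 - s) * of_real (pi\<^sup>2 / 6 - (y - c) * (2 * pi - (y - c)) / 4))
      - 1 / (s * (1 + s)) * (of_real y powr (- s) * of_real ((y - c - pi) / 2))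
      + 1 / (2 * s * (1 + s) * (1 - s)) * of_real y powr (1 - s))"
  \<comment> \<open>A free lower limit \<open>u\<close> also covers the truncated first period,
    which starts at 1.\<close>
  have piece: "(?f has_integral \<Phi> (?T n) (?T (Suc n)) - \<Phi> (?T n) u) {u..?T (Suc n)}"
    if u: "u > 0" "?T n \<le> u" "u \<le> ?T (Suc n)" for n u
  proof (rule has_integral_eq)
    let ?P = "\<lambda>y. pi\<^sup>2 / 6 - (y - ?T n) * (2 * pi - (y - ?T n)) / 4"
    show "((\<lambda>y. of_real y powr (-2 - s) * of_real (?P y)) has_integral
        \<Phi> (?T n) (?T (Suc n)) - \<Phi> (?T n) u) {u..?T (Suc n)}"
      unfolding \<Phi>_def by (rule has_integral_powr_mult_parabola[OF s u(1,3)])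
    show "of_real y powr (-2 - s) * of_real (?P y) = ?f y" if "y \<in> {u..?T (Suc n)}" for y
      using p_eq[of y n] u that by simp
  qed
  have right: "\<Phi> (?T n) (?T (Suc n)) = U (?T (Suc n)) - \<kappa> * of_real (?T (Suc n)) powr (- s)" for n
  proof -
    have "?T (Suc n) - ?T n = 2 * pi" by (simp add: algebra_simps)
    then show ?thesis unfolding \<Phi>_def U_def \<kappa>_def by (simp add: field_simps)
  qed
  have left: "\<Phi> (?T n) (?T n) = U (?T n) + \<kappa> * of_real (?T n) powr (- s)" for n
    unfolding \<Phi>_def U_def \<kappa>_def by (simp add: field_simps)
  \<comment> \<open>The lower limit 1 produces the explicit constants of the final formula.\<close>
  have start: "\<Phi> 0 1 = - ?c"
  proof -
    have 1: "- (1 / (1 + s)) * (P - x / 2 + 1 / 4) - 1 / (s * (1 + s)) * ((1 - x) / 2) + 1 / (2 * s * (1 + s) * (1 - s))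
        = - (P * (1 / (1 + s)) - x / 2 * (1 / s) - 1 / 4 * (1 / (1 - s)))" for P x :: complex
    proof -
      \<comment> \<open>Treating the reciprocals as variables reduces the partial fraction
        decompositions to consequences of three polynomial relations.\<close>
      define i j k where "i = 1 / s" "j = 1 / (1 + s)" "k = 1 / (1 - s)"
      have "s * i = 1" "(1 + s) * j = 1" "(1 - s) * k = 1"
        using s by (simp_all add: i_j_k_def)
      then have ij: "i * j = i - j" and "2 * (i * j * k) = 2 * i - j + k"
        by algebra+
      then have ijk: "i * j * k = i - j / 2 + k / 2"
        by (simp add: field_simps)
      then have "- j * (P - x / 2 + 1 / 4) - i * j * ((1 - x) / 2) + i * j * k / 2
          = - (P * j - x / 2 * i - 1 / 4 * k)"
        unfolding ijk unfolding ij by (simp add: field_simps)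
      then show ?thesis by (simp add: i_j_k_def mult_ac)
    qed
    have "of_real (pi\<^sup>2 / 6 - (1 - 0) * (2 * pi - (1 - 0)) / 4) = of_real (pi\<^sup>2 / 6) - of_real pi / 2 + (1 / 4 :: complex)"
      "of_real ((1 - 0 - pi) / 2) = (1 - of_real pi) / (2 :: complex)"
      "of_real (pi / 2) = of_real pi / (2 :: complex)"
      by (simp_all add: field_simps)
    then show ?thesis unfolding \<Phi>_def using 1[of "of_real (pi\<^sup>2 / 6)" "of_real pi"]
      by (simp only: of_real_1 powr_one_eq_one mult_1_left mult_1_right)
  qed
  have "(?f has_integral ?c + U (?T (Suc N)) - \<kappa> * of_real (?T (Suc N)) powr (- s)
           - 2 * \<kappa> * (\<Sum>n<N. of_real (?T (Suc n)) powr (- s))) {1..?T (Suc N)}"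
  proof (induction N)
    case 0
    have "(?f has_integral \<Phi> (?T 0) (?T (Suc 0)) - \<Phi> (?T 0) 1) {1..?T (Suc 0)}"
      by (rule piece) (use pi_ge_two in auto)
    moreover have "\<Phi> (?T 0) 1 = - ?c" using start by (simp only: of_nat_0 mult_zero_right)
    ultimately have "(?f has_integral U (?T (Suc 0)) - \<kappa> * of_real (?T (Suc 0)) powr (- s) - (- ?c)) {1..?T (Suc 0)}"
      by (simp only: right)
    then show ?case by (rule has_integral_eq_rhs) simp
  next
    case (Suc N)
    have "?T (Suc N) > 0" "?T (Suc N) \<le> ?T (Suc (Suc N))" by simp_all
    note piece[OF this(1) order.refl this(2)]
    moreover have "1 * 1 \<le> (2 * pi) * real (Suc N)"
      using pi_ge_two by (intro mult_mono) auto
    ultimately have "(?f has_integral (?c + U (?T (Suc N)) - \<kappa> * of_real (?T (Suc N)) powr (- s)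
           - 2 * \<kappa> * (\<Sum>n<N. of_real (?T (Suc n)) powr (- s)))
         + (\<Phi> (?T (Suc N)) (?T (Suc (Suc N))) - \<Phi> (?T (Suc N)) (?T (Suc N)))) {1..?T (Suc (Suc N))}"
      by (intro has_integral_combine[OF _ _ Suc]) simp_all
    then show ?case
      unfolding left right sum.lessThan_Suc by (rule has_integral_eq_rhs) (simp add: algebra_simps)
  qed
  then show ?thesis by (rule integral_unique)
qed

section \<open>The Dirichlet series and its continuation\<close>

lemma D_eq_tail_mellin: "D = tail_mellin p"
  by (simp add: fun_eq_iff D_def tail_mellin_def)

lemma of_real_powr_tendsto_0:
  fixes a :: complex
  assumes "Re a < 0" "filterlim f at_top F"
  shows "((\<lambda>x. of_real (f x) powr a) \<longlongrightarrow> 0) F"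
proof (rule Lim_null_comparison)
  show "eventually (\<lambda>x. norm (of_real (f x) powr a) \<le> f x powr Re a) F"
    using eventually_compose_filterlim[OF eventually_gt_at_top[of 0] assms(2)]
    by eventually_elim (simp add: norm_of_real_powr)
  show "((\<lambda>x. f x powr Re a) \<longlongrightarrow> 0) F"
    by (rule tendsto_neg_powr) (use assms in auto)
qed

text \<open>The formula over finitely many periods is solved for the partial sum, and the upper
  limit tends to infinity. The boundary terms in \<open>R\<close> vanish; the slowest, with exponent
  \<open>1 - s\<close>, does so because \<open>Re s > 1\<close>.\<close>

lemma sums_zeta_rhs:
  assumes s: "Re s > 1"
  shows "(\<lambda>n. 1 / of_nat (Suc n) powr s) sums zeta_rhs D s"
proof -
  let ?T = "\<lambda>n. 2 * pi * real (Suc n)"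
  define c where "c = of_real (pi\<^sup>2 / 6) * (1 / (1 + s)) - of_real (pi / 2) * (1 / s) - 1 / 4 * (1 / (1 - s))"
  define \<kappa> where "\<kappa> = of_real pi / (2 * s * (1 + s))"
  define R where "R = (\<lambda>y::real. - (1 / (1 + s)) * (of_real y powr (-1 - s) * of_real (pi\<^sup>2 / 6))
       + 1 / (2 * s * (1 + s) * (1 - s)) * of_real y powr (1 - s) - \<kappa> * of_real y powr (- s))"
  have s': "s \<noteq> 0" "s \<noteq> 1" "1 + s \<noteq> 0" using s by (auto simp: complex_eq_iff)
  have T: "filterlim ?T at_top sequentially"
    by (intro filterlim_tendsto_pos_mult_at_top[OF tendsto_const]
        filterlim_compose[OF filterlim_real_sequentially filterlim_Suc]) simp
  obtain C where C: "\<forall>x\<ge>0. \<bar>p x\<bar> \<le> C"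
    using periodic_bounded[of "2 * pi" p] continuous_on_p p_periodic by auto
  have "(\<lambda>n. integral {1..?T n} (\<lambda>y. of_real y powr (-2 - s) * of_real (p y))) \<longlonglongrightarrow> D (-2 - s)"
    unfolding D_eq_tail_mellin
    by (rule filterlim_compose[OF tail_mellin_tendsto[where C = C] T])
       (use C s in \<open>auto intro: continuous_on_subset[OF continuous_on_p]\<close>)
  moreover have "(\<lambda>n. R (?T n)) \<longlonglongrightarrow> - (1 / (1 + s)) * (0 * of_real (pi\<^sup>2 / 6))
       + 1 / (2 * s * (1 + s) * (1 - s)) * 0 - \<kappa> * 0"
    unfolding R_def by (intro tendsto_intros of_real_powr_tendsto_0[OF _ T]) (use s in auto)
  \<comment> \<open>Dividing by \<open>2 * \<kappa>\<close> isolates the sum of the powers of 2 pi n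
    with exponent \<open>- s\<close>; the factor \<open>of_real (2 * pi) powr s\<close> turns it
    into the Dirichlet sum.\<close>
  ultimately have "(\<lambda>n. (c + R (?T n) - integral {1..?T n} (\<lambda>y. of_real y powr (-2 - s) * of_real (p y)))
        / (2 * \<kappa>) * of_real (2 * pi) powr s) \<longlonglongrightarrow>
      (c + (- (1 / (1 + s)) * (0 * of_real (pi\<^sup>2 / 6))
       + 1 / (2 * s * (1 + s) * (1 - s)) * 0 - \<kappa> * 0) - D (-2 - s)) / (2 * \<kappa>) * of_real (2 * pi) powr s"
    by (intro tendsto_intros) (use s' in \<open>auto simp: \<kappa>_def\<close>)
  also have "(\<lambda>n. (c + R (?T n) - integral {1..?T n} (\<lambda>y. of_real y powr (-2 - s) * of_real (p y)))
        / (2 * \<kappa>) * of_real (2 * pi) powr s) = (\<lambda>N. \<Sum>n<N. 1 / of_nat (Suc n) powr s)"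
  proof
    fix N
    have "c + R (?T N) - integral {1..?T N} (\<lambda>y. of_real y powr (-2 - s) * of_real (p y))
        = 2 * \<kappa> * (\<Sum>n<N. of_real (?T n) powr (- s))"
      unfolding integral_powr_mult_p[OF s'] R_def c_def \<kappa>_def by (simp add: algebra_simps)
    also have "\<dots> / (2 * \<kappa>) * of_real (2 * pi) powr s = (\<Sum>n<N. of_real (?T n) powr (- s) * of_real (2 * pi) powr s)"
      using s' by (simp add: \<kappa>_def sum_distrib_right)
    also have "\<dots> = (\<Sum>n<N. 1 / of_nat (Suc n) powr s)"
    proof (rule sum.cong[OF refl])
      fix n
      have "of_real (?T n) powr (- s) = of_real (2 * pi) powr (- s) * of_nat (Suc n) powr (- s)"
        using powr_times_real[of "of_real (2 * pi)" "of_nat (Suc n)" "- s"] by simp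
      then show "of_real (?T n) powr (- s) * of_real (2 * pi) powr s = 1 / of_nat (Suc n) powr s"
        by (simp add: powr_minus field_simps del: of_nat_Suc)
    qed
    finally show "(c + R (?T N) - integral {1..?T N} (\<lambda>y. of_real y powr (-2 - s) * of_real (p y)))
        / (2 * \<kappa>) * of_real (2 * pi) powr s = (\<Sum>n<N. 1 / of_nat (Suc n) powr s)" .
  qed
  finally have "(\<lambda>n. 1 / of_nat (Suc n) powr s) sums ((c - D (-2 - s)) / (2 * \<kappa>) * of_real (2 * pi) powr s)"
    by (simp add: sums_def)
  also have "(c - D (-2 - s)) / (2 * \<kappa>) * of_real (2 * pi) powr s = zeta_rhs D s"
  proof -
    have "of_real (2 * pi) powr (1 - s) = of_real (2 * pi) / (of_real (2 * pi) powr s :: complex)"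
      by (simp add: powr_diff)
    then show ?thesis
      unfolding zeta_rhs_eq[OF s'] c_def[symmetric] \<kappa>_def by (simp add: mult_ac)
  qed
  finally show ?thesis .
qed

lemma holomorphic_zeta_rhs:
  assumes "E holomorphic_on UNIV"
  shows "zeta_rhs E holomorphic_on - {1}"
proof -
  have "(E \<circ> (\<lambda>s. - 2 - s)) holomorphic_on - {1}"
    by (rule holomorphic_on_compose[OF _ holomorphic_on_subset[OF assms]]) (auto intro!: holomorphic_intros)
  then have "(\<lambda>s. E (- 2 - s)) holomorphic_on - {1}" by (simp add: o_def)
  then show ?thesis unfolding zeta_rhs_def by (intro holomorphic_intros) auto
qed

theorem theorem3p1:
  fixes s :: complex
  assumes "Re s > 0" and "s \<noteq> 1"
  shows "zeta s = 2 * s * (1 + s) / of_real (2 * pi) powr (1 - s) *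
           (of_real (pi\<^sup>2 / 6) * (1 / (1 + s)) - of_real (pi / 2) * (1 / s)
              - 1 / 4 * (1 / (1 - s)) - D (- 2 - s))"
proof -
  obtain E where E: "E holomorphic_on UNIV" "\<And>a. Re a < -1 \<Longrightarrow> E a = D a"
    using tail_mellin_entire[of "2 * pi" p] continuous_on_p p_periodic integral_p
    unfolding D_eq_tail_mellin by auto
  \<comment> \<open>For \<open>Re z > 0\<close> the exponent \<open>- 2 - z\<close> has real part
    below -1, where the entire extension \<open>E\<close> coincides with \<open>D\<close>.\<close>
  have eq: "zeta_rhs E z = zeta_rhs D z" if "Re z > 0" for z
    using that by (simp add: zeta_rhs_def E(2))
  let ?spec = "\<lambda>f. f holomorphic_on - {1} \<and>
      (\<forall>s. Re s > 1 \<longrightarrow> (\<lambda>n. 1 / of_nat (Suc n) powr s) sums f s)"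
  \<comment> \<open>\<open>zeta\<close> is a Hilbert choice, so its defining properties become
    available only through a witness; \<open>zeta_rhs E\<close> is one.\<close>
  have spec: "?spec (zeta_rhs E)"
    using holomorphic_zeta_rhs[OF E(1)] sums_zeta_rhs eq by simp
  then have zeta: "?spec zeta"
    unfolding zeta_def by (rule someI[of ?spec])
  have "zeta s = zeta_rhs E s"
  proof (rule analytic_continuation_open[of "{s. Re s > 1}" "- {1}" zeta "zeta_rhs E"])
    show "{s. Re s > 1} \<noteq> {}" by (auto intro!: exI[of _ 2])
    show "connected (- {1 :: complex})" by (rule connected_punctured_universe) simp
    show "zeta z = zeta_rhs E z" if "z \<in> {s. Re s > 1}" for z
      using that spec zeta sums_unique2 by blast
  qed (use assms spec zeta in \<open>auto simp: open_halfspace_Re_gt\<close>)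
  also have "\<dots> = zeta_rhs D s" using assms by (intro eq)
  also have "\<dots> = 2 * s * (1 + s) / of_real (2 * pi) powr (1 - s) *
           (of_real (pi\<^sup>2 / 6) * (1 / (1 + s)) - of_real (pi / 2) * (1 / s)
              - 1 / 4 * (1 / (1 - s)) - D (- 2 - s))"
    by (rule zeta_rhs_eq) (use assms in \<open>auto simp: complex_eq_iff\<close>)
  finally show ?thesis .
qed

end
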